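(* Let $\{f_n\}_{n\ge1}$ and $f$ be probability density functions on $\mathbb{R}^d$ such that $f_n\to f$ in Lebesgue measure and $H(f)$ is finite. Suppose there exists a convex, nondecreasing function $\Psi:[0,\infty)\to[0,\infty)$ with $\Psi(0)=0$ and $\Psi(t)/t\to\infty$ as $t\to\infty$ such that $$\sup_n\int_{\mathbb{R}^d} f_n(x)\,\Psi\bigl(\lvert\log f_n(x)\rvert\bigr)\,dx<\infty.$$ Then each $H(f_n)$ is finite and $H(f_n)\to H(f)$.
   Context: A probability density function (pdf) on $\mathbb{R}^d$ is a measurable $f:\mathbb{R}^d\to[0,\infty)$ with $\int f\,dx=1$. The differential entropy is $H(f)=-\int_{\mathbb{R}^d} f\log f\,dx$, with natural logarithm and the convention $0\log0=0$; the integrand $f_n\Psi(\lvert\log f_n\rvert)$ is likewise taken to be $0$ where $f_n=0$. "$H(f)$ finite" means $f\log f\in L^1(\mathbb{R}^d)$. *)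

theory Defs
  imports "HOL-Analysis.Analysis"
begin

text \<open>
  ``Measurable'' is read as Lebesgue measurable (the Borel measurable functions are a special case).
\<close>

definition is_pdf :: "('a::euclidean_space \<Rightarrow> real) \<Rightarrow> bool" where
  "is_pdf f \<longleftrightarrow> f \<in> borel_measurable lebesgue \<and> (\<forall>x. 0 \<le> f x) \<and>
     (\<integral>\<^sup>+x. ennreal (f x) \<partial>lebesgue) = 1"

text \<open>
  The convention \<open>0 log 0 = 0\<close> needs no case distinction, since \<open>0 * ln 0 = 0\<close> in HOL.
  The Bochner integral is \<open>0\<close> for non-integrable functions, so \<open>diff_entropy f\<close> is
  meaningful only together with \<open>finite_entropy f\<close>.
\<close>

definition diff_entropy :: "('a::euclidean_space \<Rightarrow> real) \<Rightarrow> real" where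
  "diff_entropy f = - (\<integral>x. f x * ln (f x) \<partial>lebesgue)"

definition finite_entropy :: "('a::euclidean_space \<Rightarrow> real) \<Rightarrow> bool" where
  "finite_entropy f \<longleftrightarrow> integrable lebesgue (\<lambda>x. f x * ln (f x))"

text \<open>Global convergence in measure, i.e. not merely on sets of finite measure.\<close>

definition tendsto_in_measure :: "'a measure \<Rightarrow> (nat \<Rightarrow> 'a \<Rightarrow> real) \<Rightarrow> ('a \<Rightarrow> real) \<Rightarrow> bool" where
  "tendsto_in_measure M f g \<longleftrightarrow>
     (\<forall>\<epsilon>>0. (\<lambda>n. emeasure M {x \<in> space M. \<bar>f n x - g x\<bar> > \<epsilon>}) \<longlonglongrightarrow> 0)"

end

theory Submission
  imports Defs
begin

text \<open>
  Clip the logarithm at height \<open>K\<close>. The function \<open>u \<mapsto> u \<cdot> clip K (ln u)\<close> is Lipschitz with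
  constant \<open>K + 1\<close> on \<open>[0, \<infinity>)\<close>, so the clipped entropies converge because \<open>f\<^sub>n \<rightarrow> g\<close> in
  \<open>L\<^sup>1\<close> (Scheffe). The clipping error for \<open>f\<^sub>n\<close> is at most the integral of \<open>f\<^sub>n \<bar>ln f\<^sub>n\<bar>\<close> over
  \<open>\<bar>ln f\<^sub>n\<bar> > K\<close>, which the superlinear growth of \<open>\<Psi>\<close> makes small uniformly in \<open>n\<close>; for \<open>g\<close>
  it vanishes in the limit by dominated convergence.
\<close>

section \<open>Scheffe's lemma under convergence in measure\<close>

text \<open>Since the integrals agree, the positive and negative parts of \<open>f n - g\<close>
  have equal mass, so it suffices to control \<open>max (g x - f n x) 0\<close>. This part lies
  below the fixed integrable function \<open>g\<close>, so no integrability uniform in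
  \<open>n\<close> has to be assumed.\<close>

lemma tendsto_in_measure_imp_tendsto_L1:
  fixes f :: "nat \<Rightarrow> 'a \<Rightarrow> real"
  assumes f: "\<And>n. integrable M (f n)" and g: "integrable M g"
    and f0: "\<And>n x. 0 \<le> f n x" and g0: "\<And>x. 0 \<le> g x"
    and eq: "\<And>n. (\<integral>x. f n x \<partial>M) = (\<integral>x. g x \<partial>M)"
    and conv: "tendsto_in_measure M f g"
  shows "(\<lambda>n. \<integral>x. \<bar>f n x - g x\<bar> \<partial>M) \<longlonglongrightarrow> 0"
proof -
  have [measurable]: "f n \<in> borel_measurable M" "g \<in> borel_measurable M" for n
    using f g by auto
  \<comment> \<open>The measure of the whole space may be infinite, so a constant error \<epsilon>
    cannot be integrated; capping it by \<open>g\<close> makes its integral small.\<close>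
  have small: "(\<lambda>k. \<integral>x. min (g x) (inverse (real (Suc k))) \<partial>M) \<longlonglongrightarrow> (\<integral>x. 0 \<partial>M)"
  proof (rule integral_dominated_convergence[where w=g])
    have "(\<lambda>k. min (g x) (inverse (real (Suc k)))) \<longlonglongrightarrow> min (g x) 0" for x
      by (intro tendsto_intros LIMSEQ_inverse_real_of_nat)
    then show "AE x in M. (\<lambda>k. min (g x) (inverse (real (Suc k)))) \<longlonglongrightarrow> 0"
      using g0 by (simp add: min_absorb2)
  qed (use g g0 in auto)
  have large: "(\<lambda>k. \<integral>x. max (g x - real k) 0 \<partial>M) \<longlonglongrightarrow> (\<integral>x. 0 \<partial>M)"
  proof (rule integral_dominated_convergence[where w=g])
    have "eventually (\<lambda>k. max (g x - real k) 0 = 0) sequentially" for x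
    proof -
      obtain N where "g x \<le> real N" using real_arch_simple by blast
      then show ?thesis unfolding eventually_sequentially by (intro exI[of _ N]) auto
    qed
    then show "AE x in M. (\<lambda>k. max (g x - real k) 0) \<longlonglongrightarrow> 0"
      by (auto intro!: tendsto_eventually)
  qed (use g g0 in \<open>auto simp: max_def\<close>)
  have pos: "(\<lambda>n. \<integral>x. max (g x - f n x) 0 \<partial>M) \<longlonglongrightarrow> 0"
  proof (rule LIMSEQ_I)
    fix e :: real assume e: "e > 0"
    obtain k where k: "(\<integral>x. min (g x) (inverse (real (Suc k))) \<partial>M) < e / 3"
      using order_tendstoD(2)[OF small, of "e/3"] e
      by (auto simp: eventually_sequentially)
    obtain m where m: "(\<integral>x. max (g x - real m) 0 \<partial>M) < e / 3"
      using order_tendstoD(2)[OF large, of "e/3"] e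
      by (auto simp: eventually_sequentially)
    define \<epsilon> where "\<epsilon> = inverse (real (Suc k))"
    define A where "A n = {x \<in> space M. \<bar>f n x - g x\<bar> > \<epsilon>}" for n
    have [measurable]: "A n \<in> sets M" for n unfolding A_def by measurable
    have "\<epsilon> > 0" by (simp add: \<epsilon>_def)
    then have "(\<lambda>n. emeasure M (A n)) \<longlonglongrightarrow> 0"
      using conv unfolding tendsto_in_measure_def A_def by blast
    \<comment> \<open>The set \<open>A n\<close> will be weighted by \<open>real m\<close>, so its
      measure must beat \<open>e / 3 / m\<close>; the added 1 covers \<open>m = 0\<close>.\<close>
    then have "eventually (\<lambda>n. emeasure M (A n) < ennreal (e / 3 / (real m + 1))) sequentially"
      by (rule order_tendstoD) (use e in auto)
    then obtain N where N: "\<And>n. n \<ge> N \<Longrightarrow> emeasure M (A n) < ennreal (e / 3 / (real m + 1))"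
      by (auto simp: eventually_sequentially)
    have "(\<integral>x. max (g x - f n x) 0 \<partial>M) < e" if "n \<ge> N" for n
    proof -
      have fin: "emeasure M (A n) < \<infinity>"
        using N[OF that] by (metis ennreal_less_top infinity_ennreal_def less_trans)
      have le: "measure M (A n) \<le> e / 3 / (real m + 1)"
        using N[OF that] e unfolding measure_def
        by (intro enn2real_leI) (auto simp: less_imp_le)
      have i1: "integrable M (\<lambda>x. min (g x) \<epsilon>)"
        using g g0 \<open>\<epsilon> > 0\<close> by (intro Bochner_Integration.integrable_bound[OF g]) auto
      have i2: "integrable M (\<lambda>x. max (g x - real m) 0)"
        using g g0 by (intro Bochner_Integration.integrable_bound[OF g]) (auto simp: max_def)
      have i3: "integrable M (\<lambda>x. real m * indicator (A n) x)"
        using fin by auto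
      \<comment> \<open>Off \<open>A n\<close> the integrand is at most both \<epsilon> and
        \<open>g x\<close>. On \<open>A n\<close> it is at most \<open>g x\<close>, which is split
        at height \<open>m\<close> into a bounded part and the excess
        \<open>max (g x - real m) 0\<close>.\<close>
      have "(\<integral>x. max (g x - f n x) 0 \<partial>M)
          \<le> (\<integral>x. min (g x) \<epsilon> + real m * indicator (A n) x + max (g x - real m) 0 \<partial>M)"
      proof (rule integral_mono)
        show "integrable M (\<lambda>x. max (g x - f n x) 0)"
          using g f by auto
        fix x assume "x \<in> space M"
        then show "max (g x - f n x) 0
            \<le> min (g x) \<epsilon> + real m * indicator (A n) x + max (g x - real m) 0"
          using f0[of n x] g0[of x] \<open>\<epsilon> > 0\<close> by (auto simp: A_def indicator_def)
      qed (use i1 i2 i3 in auto)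
      also have "\<dots> = (\<integral>x. min (g x) \<epsilon> \<partial>M) + real m * measure M (A n)
          + (\<integral>x. max (g x - real m) 0 \<partial>M)"
        using i1 i2 i3 by (subst Bochner_Integration.integral_add, simp, simp,
            subst Bochner_Integration.integral_add) auto
      also have "real m * measure M (A n) \<le> real m * (e / 3 / (real m + 1))"
        using le by (intro mult_left_mono) auto
      also have "\<dots> \<le> e / 3"
        using e by (simp add: field_simps)
      finally show ?thesis using k m by (simp add: \<epsilon>_def)
    qed
    then show "\<exists>N. \<forall>n\<ge>N. norm ((\<integral>x. max (g x - f n x) 0 \<partial>M) - 0) < e"
      by (intro exI[of _ N]) (auto intro: integral_nonneg_AE)
  qed
  \<comment> \<open>Pointwise \<open>\<bar>a\<bar> = 2 * max (- a) 0 + a\<close> with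
    \<open>a = f n x - g x\<close>, and \<open>a\<close> integrates to 0.\<close>
  have "(\<integral>x. \<bar>f n x - g x\<bar> \<partial>M) = 2 * (\<integral>x. max (g x - f n x) 0 \<partial>M)" for n
  proof -
    have "(\<integral>x. \<bar>f n x - g x\<bar> \<partial>M) = (\<integral>x. 2 * max (g x - f n x) 0 + (f n x - g x) \<partial>M)"
      by (rule Bochner_Integration.integral_cong) (auto simp: max_def)
    also have "\<dots> = 2 * (\<integral>x. max (g x - f n x) 0 \<partial>M) + ((\<integral>x. f n x \<partial>M) - (\<integral>x. g x \<partial>M))"
      using f g by (subst Bochner_Integration.integral_add) auto
    finally show ?thesis using eq by simp
  qed
  with tendsto_mult_right_zero[OF pos, of 2] show ?thesis by simp
qed

section \<open>The clipped logarithm and its Lipschitz bound\<close>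

definition clip :: "real \<Rightarrow> real \<Rightarrow> real" where
  "clip K t = max (- K) (min K t)"

lemma borel_measurable_clip [measurable]: "clip K \<in> borel_measurable borel"
  unfolding clip_def by measurable

text \<open>Split the difference as \<open>(v - u) * clip K (ln v) + u * (clip K (ln v) - clip K (ln
  u))\<close>. The first term costs \<open>K * (v - u)\<close>. In the second, clipping does not
  expand distances, and \<open>ln (v / u) \<le> v / u - 1\<close> gives
  \<open>u * (ln v - ln u) \<le> v - u\<close>; it is the factor \<open>u\<close>, the smaller
  argument, that tames the singularity of the logarithm at 0.\<close>

lemma mult_clip_ln_lipschitz_le:
  assumes "0 \<le> u" "u \<le> v" "0 \<le> K"
  shows "\<bar>v * clip K (ln v) - u * clip K (ln u)\<bar> \<le> (K + 1) * (v - u)"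
proof -
  have cK: "\<bar>clip K t\<bar> \<le> K" for t using assms by (auto simp: clip_def)
  have *: "u * \<bar>clip K (ln v) - clip K (ln u)\<bar> \<le> v - u"
  proof (cases "u = 0")
    case False
    with assms have "u > 0" "v > 0" by auto
    have "ln v - ln u = ln (v / u)" using \<open>u > 0\<close> \<open>v > 0\<close> by (simp add: ln_div)
    also have "\<dots> \<le> v / u - 1" using \<open>u > 0\<close> \<open>v > 0\<close> by (intro ln_le_minus_one) auto
    finally have "u * (ln v - ln u) \<le> v - u" using \<open>u > 0\<close> by (simp add: field_simps)
    moreover have "\<bar>clip K (ln v) - clip K (ln u)\<bar> \<le> ln v - ln u"
    proof -
      have "ln u \<le> ln v" using \<open>u > 0\<close> assms by simp
      then show ?thesis using assms unfolding clip_def by linarith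
    qed
    then have "u * \<bar>clip K (ln v) - clip K (ln u)\<bar> \<le> u * (ln v - ln u)"
      using assms by (intro mult_left_mono)
    ultimately show ?thesis by linarith
  qed (use assms in auto)
  have "v * clip K (ln v) - u * clip K (ln u)
      = (v - u) * clip K (ln v) + u * (clip K (ln v) - clip K (ln u))"
    by (simp add: algebra_simps)
  also have "\<bar>\<dots>\<bar> \<le> (v - u) * \<bar>clip K (ln v)\<bar> + u * \<bar>clip K (ln v) - clip K (ln u)\<bar>"
    using assms by (intro order.trans[OF abs_triangle_ineq]) (simp add: abs_mult)
  also have "\<dots> \<le> (v - u) * K + (v - u)"
    using assms cK * by (intro add_mono mult_left_mono) auto
  finally show ?thesis by (simp add: algebra_simps)
qed

lemma mult_clip_ln_lipschitz:
  assumes "0 \<le> u" "0 \<le> v" "0 \<le> K"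
  shows "\<bar>u * clip K (ln u) - v * clip K (ln v)\<bar> \<le> (K + 1) * \<bar>u - v\<bar>"
  using mult_clip_ln_lipschitz_le[of u v K] mult_clip_ln_lipschitz_le[of v u K] assms
  by (cases "u \<le> v") (auto simp: abs_minus_commute)

section \<open>Convergence of the entropy integrals from convergence in mean\<close>

lemma tendsto_integral_mult_ln:
  fixes f :: "nat \<Rightarrow> 'a \<Rightarrow> real"
  assumes f: "\<And>n. integrable M (f n)" and g: "integrable M g"
    and f0: "\<And>n x. 0 \<le> f n x" and g0: "\<And>x. 0 \<le> g x"
    and L1: "(\<lambda>n. \<integral>x. \<bar>f n x - g x\<bar> \<partial>M) \<longlonglongrightarrow> 0"
    and fin: "integrable M (\<lambda>x. g x * ln (g x))"
    and \<Psi>: "\<And>n. integrable M (\<lambda>x. f n x * \<Psi> \<bar>ln (f n x)\<bar>)"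
    and \<Psi>0: "\<And>t. 0 \<le> t \<Longrightarrow> 0 \<le> \<Psi> t"
    and C: "\<And>n. (\<integral>x. f n x * \<Psi> \<bar>ln (f n x)\<bar> \<partial>M) \<le> C"
    and superlin: "filterlim (\<lambda>t. \<Psi> t / t) at_top at_top"
  shows "\<And>n. integrable M (\<lambda>x. f n x * ln (f n x))"
    and "(\<lambda>n. \<integral>x. f n x * ln (f n x) \<partial>M) \<longlonglongrightarrow> (\<integral>x. g x * ln (g x) \<partial>M)"
proof -
  have [measurable]: "f n \<in> borel_measurable M" "g \<in> borel_measurable M" for n
    using f g by auto
  define cl where "cl K h x = h x * clip K (ln (h x))" for K h and x :: 'a
  have cl: "integrable M (cl K h)" if "integrable M h" "0 \<le> K" for K h
  proof (rule Bochner_Integration.integrable_bound)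
    show "integrable M (\<lambda>x. K * h x)" using that by auto
    have [measurable]: "h \<in> borel_measurable M" using that by auto
    show "cl K h \<in> borel_measurable M" unfolding cl_def by measurable
    have "\<bar>cl K h x\<bar> \<le> \<bar>K * h x\<bar>" for x
    proof -
      have "\<bar>h x\<bar> * \<bar>clip K (ln (h x))\<bar> \<le> \<bar>h x\<bar> * K"
        using that by (intro mult_left_mono) (auto simp: clip_def)
      then show ?thesis using that by (simp add: cl_def abs_mult mult.commute)
    qed
    then show "AE x in M. norm (cl K h x) \<le> norm (K * h x)" by simp
  qed
  \<comment> \<open>Choose \<open>K0\<close> so that \<open>\<Psi> t / t\<close> is at least
    \<open>inverse s\<close> beyond it. Where \<open>\<bar>ln (f n x)\<bar> \<le> K\<close> clipping
    changes nothing; elsewhere the error is at most \<open>\<bar>ln (f n x)\<bar>\<close>, which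
    \<open>s * \<Psi>\<close> dominates. The bound is stated for all \<open>K \<ge> K0\<close>
    because \<open>K\<close> must later also be large for \<open>g\<close>.\<close>
  have bound: "\<exists>K0. \<forall>K\<ge>K0. 0 \<le> K \<and> (\<forall>n x. \<bar>f n x * ln (f n x) - cl K (f n) x\<bar> \<le> s * (f n x * \<Psi> \<bar>ln (f n x)\<bar>))"
    if s: "s > 0" for s
  proof -
    have "eventually (\<lambda>t. inverse s \<le> \<Psi> t / t) at_top"
      using superlin by (simp add: filterlim_at_top)
    then obtain K0 where K0: "\<And>t. t \<ge> K0 \<Longrightarrow> inverse s \<le> \<Psi> t / t"
      by (auto simp: eventually_at_top_linorder)
    have "\<bar>f n x * ln (f n x) - cl K (f n) x\<bar> \<le> s * (f n x * \<Psi> \<bar>ln (f n x)\<bar>)"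
      if K: "K \<ge> max K0 0" for K n x
    proof -
      let ?t = "ln (f n x)"
      have "\<bar>?t - clip K ?t\<bar> \<le> s * \<Psi> \<bar>?t\<bar>"
      proof (cases "\<bar>?t\<bar> \<le> K")
        case True
        then show ?thesis using s \<Psi>0[of "\<bar>?t\<bar>"] by (auto simp: clip_def)
      next
        case False
        then have pos: "\<bar>?t\<bar> > 0" using K by linarith
        have "inverse s \<le> \<Psi> \<bar>?t\<bar> / \<bar>?t\<bar>" using False K by (intro K0) linarith
        then have "\<bar>?t\<bar> \<le> s * \<Psi> \<bar>?t\<bar>" using pos s by (simp add: field_simps)
        moreover have "\<bar>?t - clip K ?t\<bar> \<le> \<bar>?t\<bar>" using K by (auto simp: clip_def)
        ultimately show ?thesis by linarith
      qed
      then have "f n x * \<bar>?t - clip K ?t\<bar> \<le> f n x * (s * \<Psi> \<bar>?t\<bar>)"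
        using f0 by (intro mult_left_mono)
      moreover have "\<bar>f n x * ?t - cl K (f n) x\<bar> = f n x * \<bar>?t - clip K ?t\<bar>"
        using f0[of n x] by (simp add: cl_def right_diff_distrib[symmetric] abs_mult)
      ultimately show ?thesis by (simp add: ac_simps)
    qed
    then show ?thesis by (intro exI[of _ "max K0 0"]) auto
  qed
  \<comment> \<open>Any fixed \<open>s\<close> would do here: the clipped function and the clipping
    error are both integrable.\<close>
  show int: "integrable M (\<lambda>x. f n x * ln (f n x))" for n
  proof -
    obtain K where K: "0 \<le> K"
      "\<And>x. \<bar>f n x * ln (f n x) - cl K (f n) x\<bar> \<le> 1 * (f n x * \<Psi> \<bar>ln (f n x)\<bar>)"
      using bound[of 1] by force
    have [measurable]: "cl K (f n) \<in> borel_measurable M" using cl[OF f K(1)] by auto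
    have "integrable M (\<lambda>x. f n x * ln (f n x) - cl K (f n) x)"
      by (rule Bochner_Integration.integrable_bound[OF \<Psi>[of n]])
        (use K(2) in \<open>auto intro!: AE_I2 order.trans[OF _ abs_ge_self]\<close>)
    from Bochner_Integration.integrable_add[OF this cl[OF f[of n] K(1)]] show ?thesis by simp
  qed
  \<comment> \<open>For each \<open>x\<close> the sequence becomes constant once \<open>k\<close>
    exceeds \<open>\<bar>ln (g x)\<bar>\<close>, and clipping never increases the absolute
    value.\<close>
  have clipped: "(\<lambda>k. \<integral>x. cl (real k) g x \<partial>M) \<longlonglongrightarrow> (\<integral>x. g x * ln (g x) \<partial>M)"
  proof (rule integral_dominated_convergence[where w="\<lambda>x. \<bar>g x * ln (g x)\<bar>"])
    have "eventually (\<lambda>k. cl (real k) g x = g x * ln (g x)) sequentially" for x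
    proof -
      obtain N where "\<bar>ln (g x)\<bar> \<le> real N" using real_arch_simple by blast
      then show ?thesis unfolding eventually_sequentially
        by (intro exI[of _ N]) (auto simp: cl_def clip_def)
    qed
    then show "AE x in M. (\<lambda>k. cl (real k) g x) \<longlonglongrightarrow> g x * ln (g x)"
      by (auto intro!: tendsto_eventually)
    have "\<bar>g x\<bar> * \<bar>clip (real k) (ln (g x))\<bar> \<le> \<bar>g x\<bar> * \<bar>ln (g x)\<bar>" for k x
      by (intro mult_left_mono) (auto simp: clip_def)
    then show "AE x in M. norm (cl (real k) g x) \<le> \<bar>g x * ln (g x)\<bar>" for k
      by (simp add: cl_def abs_mult)
  qed (use fin cl[OF g] in auto)
  show "(\<lambda>n. \<integral>x. f n x * ln (f n x) \<partial>M) \<longlonglongrightarrow> (\<integral>x. g x * ln (g x) \<partial>M)"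
  proof (rule LIMSEQ_I)
    fix e :: real assume e: "e > 0"
    \<comment> \<open>The denominator \<open>\<bar>C\<bar> + 1\<close> keeps \<open>s\<close>
      positive for every \<open>C\<close> and brings the clipping error for \<open>f n\<close> below
      \<open>e / 3\<close>.\<close>
    define s where "s = e / 3 / (\<bar>C\<bar> + 1)"
    have s: "s > 0" using e by (simp add: s_def)
    have sC: "s * C \<le> e / 3"
    proof -
      have "s * C \<le> s * (\<bar>C\<bar> + 1)" using s by (intro mult_left_mono) auto
      also have "\<dots> = e / 3" unfolding s_def by (rule nonzero_eq_divide_eq[THEN iffD1]) auto
      finally show ?thesis .
    qed
    obtain K0 where K0: "\<And>K. K \<ge> K0 \<Longrightarrow> 0 \<le> K \<and> (\<forall>n x. \<bar>f n x * ln (f n x) - cl K (f n) x\<bar>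
        \<le> s * (f n x * \<Psi> \<bar>ln (f n x)\<bar>))"
      using bound[OF s] by blast
    obtain N1 where N1: "\<And>k. k \<ge> N1 \<Longrightarrow>
        norm ((\<integral>x. cl (real k) g x \<partial>M) - (\<integral>x. g x * ln (g x) \<partial>M)) < e / 3"
      using LIMSEQ_D[OF clipped, of "e/3"] e by auto
    obtain N2 where N2: "K0 \<le> real N2" using real_arch_simple by blast
    \<comment> \<open>One level serves both the clipping error of \<open>g\<close> and that of every
      \<open>f n\<close>. It is fixed before \<open>n\<close>, so the Lipschitz constant
      \<open>K + 1\<close> can be absorbed into the choice of \<open>N\<close>.\<close>
    define K where "K = real (max N1 N2)"
    have K: "0 \<le> K" and Ks: "\<And>n x. \<bar>f n x * ln (f n x) - cl K (f n) x\<bar> \<le> s * (f n x * \<Psi> \<bar>ln (f n x)\<bar>)"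
      using K0[of K] N2 by (auto simp: K_def)
    have gK: "\<bar>(\<integral>x. cl K g x \<partial>M) - (\<integral>x. g x * ln (g x) \<partial>M)\<bar> < e / 3"
      using N1[of "max N1 N2"] by (simp add: K_def)
    obtain N where N: "\<And>n. n \<ge> N \<Longrightarrow> (\<integral>x. \<bar>f n x - g x\<bar> \<partial>M) < e / 3 / (K + 1)"
      using order_tendstoD(2)[OF L1, of "e / 3 / (K + 1)"] e K
      by (auto simp: eventually_sequentially)
    have "\<bar>(\<integral>x. f n x * ln (f n x) \<partial>M) - (\<integral>x. g x * ln (g x) \<partial>M)\<bar> < e" if "n \<ge> N" for n
    proof -
      have "\<bar>(\<integral>x. f n x * ln (f n x) \<partial>M) - (\<integral>x. cl K (f n) x \<partial>M)\<bar>
          = \<bar>\<integral>x. f n x * ln (f n x) - cl K (f n) x \<partial>M\<bar>"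
        using int cl[OF f K] by (subst Bochner_Integration.integral_diff) auto
      also have "\<dots> \<le> (\<integral>x. \<bar>f n x * ln (f n x) - cl K (f n) x\<bar> \<partial>M)"
        by (rule integral_abs_bound)
      also have "\<dots> \<le> (\<integral>x. s * (f n x * \<Psi> \<bar>ln (f n x)\<bar>) \<partial>M)"
        using int cl[OF f K] \<Psi> Ks by (intro integral_mono integrable_mult_right) auto
      also have "\<dots> \<le> s * C" using C[of n] s by simp
      finally have 1: "\<bar>(\<integral>x. f n x * ln (f n x) \<partial>M) - (\<integral>x. cl K (f n) x \<partial>M)\<bar> \<le> e / 3"
        using sC by linarith
      have "\<bar>(\<integral>x. cl K (f n) x \<partial>M) - (\<integral>x. cl K g x \<partial>M)\<bar>
          = \<bar>\<integral>x. cl K (f n) x - cl K g x \<partial>M\<bar>"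
        using cl[OF f K] cl[OF g K] by (subst Bochner_Integration.integral_diff) auto
      also have "\<dots> \<le> (\<integral>x. \<bar>cl K (f n) x - cl K g x\<bar> \<partial>M)"
        by (rule integral_abs_bound)
      also have "\<dots> \<le> (\<integral>x. (K + 1) * \<bar>f n x - g x\<bar> \<partial>M)"
      proof (rule integral_mono)
        show "\<bar>cl K (f n) x - cl K g x\<bar> \<le> (K + 1) * \<bar>f n x - g x\<bar>" for x
          unfolding cl_def by (intro mult_clip_ln_lipschitz f0 g0 K)
        show "integrable M (\<lambda>x. \<bar>cl K (f n) x - cl K g x\<bar>)"
          using cl[OF f K] cl[OF g K] by auto
        show "integrable M (\<lambda>x. (K + 1) * \<bar>f n x - g x\<bar>)" using f g by auto
      qed
      also have "\<dots> = (K + 1) * (\<integral>x. \<bar>f n x - g x\<bar> \<partial>M)" by simp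
      also have "\<dots> < (K + 1) * (e / 3 / (K + 1))"
        using N[OF that] K by (intro mult_strict_left_mono) auto
      also have "\<dots> = e / 3" using K by (simp add: add_divide_distrib[symmetric] field_simps)
      finally show ?thesis using 1 gK by linarith
    qed
    then show "\<exists>N. \<forall>n\<ge>N. norm ((\<integral>x. f n x * ln (f n x) \<partial>M) - (\<integral>x. g x * ln (g x) \<partial>M)) < e"
      by auto
  qed
qed

section \<open>Application to densities on Euclidean space\<close>

lemma is_pdf_integrable:
  assumes "is_pdf f"
  shows "integrable lebesgue f" and "(\<integral>x. f x \<partial>lebesgue) = 1"
proof -
  have m: "f \<in> borel_measurable lebesgue" and nn: "\<And>x. 0 \<le> f x"
    and 1: "(\<integral>\<^sup>+x. ennreal (f x) \<partial>lebesgue) = 1"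
    using assms by (auto simp: is_pdf_def)
  show "integrable lebesgue f" using m nn 1 by (intro integrableI_nonneg) auto
  show "(\<integral>x. f x \<partial>lebesgue) = 1" using m nn 1 by (subst integral_eq_nn_integral) auto
qed

theorem theorem8:
  fixes f :: "nat \<Rightarrow> real ^ 'd \<Rightarrow> real" and g :: "real ^ 'd \<Rightarrow> real" and \<Psi> :: "real \<Rightarrow> real"
  assumes "\<And>n. is_pdf (f n)"
    and "is_pdf g"
    and "tendsto_in_measure lebesgue f g"
    and "finite_entropy g"
    and "convex_on {0..} \<Psi>"
    and "mono_on {0..} \<Psi>"
    and "\<And>t. t \<ge> 0 \<Longrightarrow> \<Psi> t \<ge> 0"
    and "\<Psi> 0 = 0"
    and "filterlim (\<lambda>t. \<Psi> t / t) at_top at_top"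
    and "(SUP n. \<integral>\<^sup>+x. ennreal (f n x * \<Psi> \<bar>ln (f n x)\<bar>) \<partial>lebesgue) < \<infinity>"
  shows "(\<forall>n. finite_entropy (f n)) \<and> (\<lambda>n. diff_entropy (f n)) \<longlonglongrightarrow> diff_entropy g"
proof -
  have f0: "\<And>n x. 0 \<le> f n x" and g0: "\<And>x. 0 \<le> g x"
    and [measurable]: "\<And>n. f n \<in> borel_measurable lebesgue"
    using assms(1,2) by (auto simp: is_pdf_def)
  note f = is_pdf_integrable[OF assms(1)] and g = is_pdf_integrable[OF assms(2)]
  let ?S = "SUP n. \<integral>\<^sup>+x. ennreal (f n x * \<Psi> \<bar>ln (f n x)\<bar>) \<partial>lebesgue"
  \<comment> \<open>Measurability of \<Psi> comes from monotonicity, which is given only on the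
    half-line. Composing with \<open>max 0\<close> extends it to a monotone function on all reals
    that agrees with \<Psi> at \<open>\<bar>ln (f n x)\<bar>\<close>.\<close>
  have "mono (\<lambda>t. \<Psi> (max 0 t))"
    by (intro monoI mono_onD[OF assms(6)]) auto
  then have [measurable]: "(\<lambda>t. \<Psi> (max 0 t)) \<in> borel_measurable borel"
    by (rule borel_measurable_mono)
  have "(\<lambda>x. f n x * \<Psi> (max 0 \<bar>ln (f n x)\<bar>)) \<in> borel_measurable lebesgue" for n
    by measurable
  then have meas: "(\<lambda>x. f n x * \<Psi> \<bar>ln (f n x)\<bar>) \<in> borel_measurable lebesgue" for n
    by (simp add: max_absorb2)
  have nonneg: "0 \<le> f n x * \<Psi> \<bar>ln (f n x)\<bar>" for n x
    using f0 assms(7) by simp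
  have le: "(\<integral>\<^sup>+x. ennreal (f n x * \<Psi> \<bar>ln (f n x)\<bar>) \<partial>lebesgue) \<le> ?S" for n
    by (rule SUP_upper) simp
  have int: "integrable lebesgue (\<lambda>x. f n x * \<Psi> \<bar>ln (f n x)\<bar>)" for n
    using meas nonneg le_less_trans[OF le assms(10)] by (intro integrableI_nonneg) auto
  \<comment> \<open>Finiteness of the supremum matters: \<open>enn2real\<close> sends infinity to 0
    and is monotone only below it.\<close>
  have C: "(\<integral>x. f n x * \<Psi> \<bar>ln (f n x)\<bar> \<partial>lebesgue) \<le> enn2real ?S" for n
    using meas nonneg le assms(10)
    by (subst integral_eq_nn_integral) (auto intro!: enn2real_mono)
  have L1: "(\<lambda>n. \<integral>x. \<bar>f n x - g x\<bar> \<partial>lebesgue) \<longlonglongrightarrow> 0"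
    by (rule tendsto_in_measure_imp_tendsto_L1) (use f g f0 g0 assms(3) in auto)
  note res = tendsto_integral_mult_ln[OF f(1) g(1) f0 g0 L1 assms(4)[unfolded finite_entropy_def]
      int assms(7) C assms(9)]
  from res show ?thesis
    unfolding finite_entropy_def diff_entropy_def by (auto intro: tendsto_minus)
qed

end
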